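(* If $n\geqslant 3$ is an odd integer, then there is an antichain of size $\dfrac{(n-1)!}{2^{(n-3)/2}}$ in the Bruhat order of $\mathcal{A}(n,2)$.
   Context: $\mathcal{A}(n,k)$ denotes the class of all $n\times n$ matrices with entries in $\{0,1\}$ in which every row and every column sums to $k$. For an $m\times n$ $(0,1)$-matrix $A=[a_{ij}]$ let $\sigma_{ij}(A)=\sum_{k=1}^{i}\sum_{\ell=1}^{j}a_{k\ell}$. For $A,C$ in the same class, $A\preceq_B C$ (Bruhat order) iff $\sigma_{ij}(A)\geqslant\sigma_{ij}(C)$ for all $i,j$. An antichain is a set of pairwise incomparable elements. *)

theory Defs
  imports Complex_Main "Jordan_Normal_Form.Matrix"
begin

definition zero_one_class :: "nat \<Rightarrow> nat \<Rightarrow> nat mat set" where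
  "zero_one_class n k =
     {A \<in> carrier_mat n n.
        (\<forall>i<n. \<forall>j<n. A $$ (i, j) \<in> {0, 1}) \<and>
        (\<forall>i<n. (\<Sum>j<n. A $$ (i, j)) = k) \<and>
        (\<forall>j<n. (\<Sum>i<n. A $$ (i, j)) = k)}"

text \<open>Matrix entries are indexed from 0, so the leading \<open>i\<close> by \<open>j\<close> block consists of the
  entries with row index below \<open>i\<close> and column index below \<open>j\<close>.\<close>

definition corner_sum :: "nat mat \<Rightarrow> nat \<Rightarrow> nat \<Rightarrow> nat" where
  "corner_sum A i j = (\<Sum>k<i. \<Sum>l<j. A $$ (k, l))"

text \<open>Only meaningful for two matrices of the same dimensions. Larger corner sums mean smaller
  in the order.\<close>

definition bruhat_le :: "nat mat \<Rightarrow> nat mat \<Rightarrow> bool" where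
  "bruhat_le A C \<longleftrightarrow>
     (\<forall>i\<in>{1..dim_row A}. \<forall>j\<in>{1..dim_col A}. corner_sum A i j \<ge> corner_sum C i j)"

definition is_antichain :: "('a \<Rightarrow> 'a \<Rightarrow> bool) \<Rightarrow> 'a set \<Rightarrow> bool" where
  "is_antichain R S \<longleftrightarrow> (\<forall>x\<in>S. \<forall>y\<in>S. x \<noteq> y \<longrightarrow> \<not> R x y \<and> \<not> R y x)"

end

theory Submission
  imports Defs "HOL-Combinatorics.Multiset_Permutations"
begin

text \<open>
  Write \<open>n = 2h + 3\<close>. The sum of all corner sums of a matrix is
  \<open>\<Sum>k l. (n - k) * (n - l) * A (k, l)\<close>; it is strictly monotone for the Bruhat order, so any family
  on which it is constant is an antichain. Take the matrices whose columns have one of the supports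
  \<open>{s, 2h + 2 - s}\<close> for \<open>s < h\<close> (each occurring twice), \<open>{h, h + 2}\<close>, \<open>{h, h + 1}\<close>, \<open>{h + 1, h + 2}\<close>
  (each occurring once), where the last two supports occur at consecutive positions, in this order.
  The columns of the symmetric kind have the same weight, and the two remaining columns deviate
  from it by \<open>1\<close> and \<open>-1\<close>, so adjacency makes the sum constant. Such matrices correspond to words of
  length \<open>n - 1\<close> in which \<open>h\<close> letters occur twice and two letters occur once.
\<close>

section \<open>The total of the corner sums\<close>

lemma corner_sum_0 [simp]: "corner_sum A 0 j = 0" "corner_sum A i 0 = 0"
  by (simp_all add: corner_sum_def)

text \<open>Differencing in the row index recovers the prefix sums of each row, and differencing
  those recovers the entries.\<close>

lemma corner_sum_inject:
  assumes A: "A \<in> carrier_mat m n" and C: "C \<in> carrier_mat m n"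
    and eq: "\<And>i j. i \<in> {1..m} \<Longrightarrow> j \<in> {1..n} \<Longrightarrow> corner_sum A i j = corner_sum C i j"
  shows "A = C"
proof (rule eq_matI)
  have eq': "corner_sum A i j = corner_sum C i j" if "i \<le> m" "j \<le> n" for i j
    using eq[of i j] that by (cases "i = 0 \<or> j = 0") auto
  have row: "(\<Sum>l<j. A $$ (i, l)) = (\<Sum>l<j. C $$ (i, l))" if "i < m" "j \<le> n" for i j
    using eq'[of "Suc i" j] eq'[of i j] that by (simp add: corner_sum_def)
  show "A $$ (i, j) = C $$ (i, j)" if "i < dim_row C" "j < dim_col C" for i j
    using row[of i "Suc j"] row[of i j] that C by simp
qed (use A C in auto)

definition corner_total :: "nat mat \<Rightarrow> nat" where
  "corner_total A = (\<Sum>i\<in>{1..dim_row A}. \<Sum>j\<in>{1..dim_col A}. corner_sum A i j)"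

text \<open>Termwise comparable sums with equal totals agree termwise. Hence distinct matrices with
  the same \<open>corner_total\<close> are incomparable.\<close>

lemma bruhat_le_corner_total_eq:
  assumes A: "A \<in> carrier_mat m n" and C: "C \<in> carrier_mat m n"
    and le: "bruhat_le A C" and total: "corner_total A = corner_total C"
  shows "A = C"
proof (rule corner_sum_inject[OF A C])
  fix i j assume ij: "i \<in> {1..m}" "j \<in> {1..n}"
  have le': "corner_sum C i j \<le> corner_sum A i j" if "i \<in> {1..m}" "j \<in> {1..n}" for i j
    using le that A by (auto simp: bruhat_le_def)
  have "(\<Sum>i\<in>{1..m}. \<Sum>j\<in>{1..n}. corner_sum C i j) = (\<Sum>i\<in>{1..m}. \<Sum>j\<in>{1..n}. corner_sum A i j)"
    using total A C by (simp add: corner_total_def)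
  hence "(\<Sum>p\<in>{1..m}\<times>{1..n}. corner_sum C (fst p) (snd p)) =
         (\<Sum>p\<in>{1..m}\<times>{1..n}. corner_sum A (fst p) (snd p))"
    by (simp add: sum.cartesian_product case_prod_beta)
  from sum_mono_inv[OF this, of "(i, j)"] le' ij
  show "corner_sum A i j = corner_sum C i j" by auto
qed

lemma sum_atLeastAtMost_lessThan:
  fixes f :: "nat \<Rightarrow> nat"
  shows "(\<Sum>i\<in>{1..n}. \<Sum>k<i. f k) = (\<Sum>k<n. (n - k) * f k)"
proof (induction n)
  case (Suc n)
  have "(\<Sum>k<n. (Suc n - k) * f k) = (\<Sum>k<n. (n - k) * f k) + (\<Sum>k<n. f k)"
    unfolding sum.distrib[symmetric] by (rule sum.cong) (auto simp: Suc_diff_le)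
  with Suc show ?case by simp
qed simp

lemma corner_total_eq:
  assumes "A \<in> carrier_mat m n"
  shows "corner_total A = (\<Sum>l<n. (n - l) * (\<Sum>k<m. (m - k) * A $$ (k, l)))"
proof -
  \<comment> \<open>Exchanging the sums over \<open>j\<close> and \<open>k\<close> makes both index
    pairs fit the preceding lemma.\<close>
  have "corner_total A = (\<Sum>i\<in>{1..m}. \<Sum>k<i. \<Sum>j\<in>{1..n}. \<Sum>l<j. A $$ (k, l))"
    using assms unfolding corner_total_def corner_sum_def
    by (auto intro!: sum.cong sum.swap)
  also have "\<dots> = (\<Sum>k<m. \<Sum>l<n. (m - k) * ((n - l) * A $$ (k, l)))"
    by (simp only: sum_atLeastAtMost_lessThan sum_distrib_left)
  also have "\<dots> = (\<Sum>l<n. (n - l) * (\<Sum>k<m. (m - k) * A $$ (k, l)))"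
    by (subst sum.swap) (simp add: sum_distrib_left mult.left_commute)
  finally show ?thesis .
qed

section \<open>Matrices with prescribed column supports\<close>

text \<open>Up to \<open>h\<close>, the letter names a pair of rows symmetric about the middle row
  \<open>h + 1\<close>. The letters \<open>h + 1\<close> and \<open>h + 2\<close> name the two
  asymmetric pairs.\<close>

definition support :: "nat \<Rightarrow> nat \<Rightarrow> nat set" where
  "support h s = (if s \<le> h then {s, 2 * h + 2 - s} else {s - 1, s})"

lemma support_subset: "s \<le> h + 2 \<Longrightarrow> support h s \<subseteq> {..<2 * h + 3}"
  by (auto simp: support_def)

lemma card_support: "s \<le> h + 2 \<Longrightarrow> card (support h s) = 2"
  by (auto simp: support_def card_insert_if)

lemma inj_on_support: "inj_on (support h) {..h + 2}"
  by (auto simp: inj_on_def support_def doubleton_eq_iff split: if_splits)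

text \<open>The weights of the two rows add up to \<open>2 * h + 4\<close>, plus 1 for the letter
  \<open>h + 1\<close> and minus 1 for \<open>h + 2\<close>. Indicators on both sides avoid
  subtraction on naturals.\<close>

lemma sum_support_weight:
  assumes "s \<le> h + 2"
  shows "(\<Sum>k\<in>support h s. 2 * h + 3 - k) + of_bool (s = h + 2) = 2 * h + 4 + of_bool (s = h + 1)"
proof -
  consider "s \<le> h" | "s = h + 1" | "s = h + 2" using assms by linarith
  thus ?thesis by cases (auto simp: support_def)
qed

definition support_mat :: "nat \<Rightarrow> nat list \<Rightarrow> nat mat" where
  "support_mat h ys =
     mat (2 * h + 3) (2 * h + 3) (\<lambda>(i, j). of_bool (i \<in> support h (ys ! j)))"

lemma support_mat_carrier: "support_mat h ys \<in> carrier_mat (2 * h + 3) (2 * h + 3)"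
  by (simp add: support_mat_def)

lemma support_mat_inject:
  assumes "support_mat h ys = support_mat h zs"
    and "length ys = 2 * h + 3" "length zs = 2 * h + 3"
    and "set ys \<subseteq> {..h + 2}" "set zs \<subseteq> {..h + 2}"
  shows "ys = zs"
proof (rule nth_equalityI)
  fix j assume j: "j < length ys"
  have in_range: "ys ! j \<in> {..h + 2}" "zs ! j \<in> {..h + 2}"
    using assms j nth_mem by (metis subsetD)+
  have "i \<in> support h (ys ! j) \<longleftrightarrow> i \<in> support h (zs ! j)" if "i < 2 * h + 3" for i
    using arg_cong[OF assms(1), of "\<lambda>A. A $$ (i, j)"] that j assms(2)
    by (simp add: support_mat_def of_bool_def split: if_splits)
  hence "support h (ys ! j) = support h (zs ! j)"
    using support_subset in_range by blast
  thus "ys ! j = zs ! j"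
    using in_range inj_on_support by (metis inj_onD)
qed (use assms in simp)

text \<open>A row outside \<open>h\<close>, \<open>h + 1\<close>, \<open>h + 2\<close> lies in
  exactly one symmetric support, which is counted twice. The three middle rows are the vertices of a
  triangle whose edges are the supports of \<open>h\<close>, \<open>h + 1\<close>,
  \<open>h + 2\<close>, so each has degree 2.\<close>

lemma sum_of_bool_support:
  assumes "i < 2 * h + 3"
  shows "(\<Sum>s<h. of_bool (i \<in> support h s)) + (\<Sum>s<h + 3. of_bool (i \<in> support h s)) = (2::nat)"
proof -
  have "(\<Sum>s<h. of_bool (i \<in> support h s)) =
        (\<Sum>s<h. of_bool (s = i) + of_bool (s = 2 * h + 2 - i) :: nat)"
    by (rule sum.cong) (use assms in \<open>auto simp: support_def\<close>)
  also have "\<dots> = of_bool (i < h) + of_bool (2 * h + 2 - i < h)"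
    by (simp add: sum.distrib of_bool_def)
  finally show ?thesis
    using assms by (auto simp: numeral_3_eq_3 support_def)
qed

lemma support_mat_in_zero_one_class:
  assumes "mset ys = mset [0..<h] + mset [0..<h + 3]"
  shows "support_mat h ys \<in> zero_one_class (2 * h + 3) 2"
proof -
  let ?n = "2 * h + 3"
  have len: "length ys = ?n"
    using arg_cong[OF assms, of size] by simp
  have set: "set ys = {..<h + 3}"
    using arg_cong[OF assms, of set_mset] by auto
  have rows: "(\<Sum>j<?n. support_mat h ys $$ (i, j)) = 2" if "i < ?n" for i
  proof -
    have "(\<Sum>j<?n. support_mat h ys $$ (i, j)) = (\<Sum>j<length ys. of_bool (i \<in> support h (ys ! j)))"
      using that len by (auto simp: support_mat_def intro!: sum.cong)
    also have "\<dots> = sum_list (map (\<lambda>s. of_bool (i \<in> support h s)) ys)"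
      by (simp add: sum_list_sum_nth atLeast0LessThan)
    \<comment> \<open>A row sum ignores the order of the columns, so only the multiset of letters
      matters.\<close>
    also have "\<dots> = sum_mset (image_mset (\<lambda>s. of_bool (i \<in> support h s)) (mset ys))"
      by (simp flip: sum_mset_sum_list)
    also have "\<dots> = (\<Sum>s<h. of_bool (i \<in> support h s)) + (\<Sum>s<h + 3. of_bool (i \<in> support h s))"
      unfolding assms
      by (simp only: image_mset_union sum_mset.union mset_map[symmetric] sum_mset_sum_list
          interv_sum_list_conv_sum_set_nat set_upt atLeast0LessThan)
    finally show ?thesis using sum_of_bool_support[OF that] by simp
  qed
  have cols: "(\<Sum>i<?n. support_mat h ys $$ (i, j)) = 2" if "j < ?n" for j
  proof -
    have s: "ys ! j \<le> h + 2" using nth_mem[of j ys] set len that by auto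
    have "(\<Sum>i<?n. support_mat h ys $$ (i, j)) = (\<Sum>i<?n. of_bool (i \<in> support h (ys ! j)))"
      using that by (auto simp: support_mat_def intro!: sum.cong)
    also have "\<dots> = card ({..<?n} \<inter> support h (ys ! j))"
      by (simp add: Int_def)
    also have "{..<?n} \<inter> support h (ys ! j) = support h (ys ! j)"
      using support_subset[OF s] by blast
    finally show ?thesis using card_support[OF s] by simp
  qed
  show ?thesis
    using rows cols support_mat_carrier
    by (auto simp: zero_one_class_def support_mat_def)
qed

text \<open>With \<open>p = length us\<close>, the excess at column \<open>p\<close> contributes
  \<open>n - p\<close> and the deficit at the next column removes \<open>n - (p + 1)\<close>. The
  net contribution is 1, wherever the pair stands.\<close>

lemma corner_total_support_mat:
  assumes len: "length ys = 2 * h + 3" and ys: "ys = us @ [h + 1, h + 2] @ vs"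
    and us: "set us \<subseteq> {..h}" and vs: "set vs \<subseteq> {..h}"
  shows "corner_total (support_mat h ys) = (\<Sum>l<2 * h + 3. (2 * h + 3 - l) * (2 * h + 4)) + 1"
proof -
  let ?n = "2 * h + 3" and ?p = "length us"
  let ?w = "\<lambda>l. \<Sum>k\<in>support h (ys ! l). ?n - k"
  have p: "?p + 1 < ?n" using len ys by simp
  have nth: "ys ! l \<le> h + 2" "ys ! l = h + 1 \<longleftrightarrow> l = ?p" "ys ! l = h + 2 \<longleftrightarrow> l = ?p + 1"
    if "l < ?n" for l
  proof -
    consider "l < ?p" | "l = ?p" | "l = ?p + 1" | "l > ?p + 1" by linarith
    hence "ys ! l \<le> h + 2 \<and> (ys ! l = h + 1 \<longleftrightarrow> l = ?p) \<and> (ys ! l = h + 2 \<longleftrightarrow> l = ?p + 1)"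
    proof cases
      case 1
      hence "ys ! l = us ! l" by (simp add: ys nth_append)
      moreover have "us ! l \<le> h" using us nth_mem[OF 1] by auto
      ultimately show ?thesis using 1 by simp
    next
      case 4
      then obtain d where d: "l = ?p + 2 + d" using less_iff_Suc_add by auto
      hence "ys ! l = vs ! d" by (simp add: ys nth_append)
      moreover have "d < length vs" using that len ys d by simp
      hence "vs ! d \<le> h" using vs nth_mem by blast
      ultimately show ?thesis using 4 by simp
    qed (auto simp: ys nth_append)
    thus "ys ! l \<le> h + 2" "ys ! l = h + 1 \<longleftrightarrow> l = ?p" "ys ! l = h + 2 \<longleftrightarrow> l = ?p + 1" by auto
  qed
  have "corner_total (support_mat h ys) = (\<Sum>l<?n. (?n - l) * ?w l)"
  proof -
    have "(\<Sum>k<?n. (?n - k) * support_mat h ys $$ (k, l)) = ?w l" if "l < ?n" for l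
    proof -
      have "(\<Sum>k<?n. (?n - k) * support_mat h ys $$ (k, l)) =
            (\<Sum>k<?n. if k \<in> support h (ys ! l) then ?n - k else 0)"
        using that by (intro sum.cong refl) (simp add: support_mat_def)
      also have "\<dots> = (\<Sum>k\<in>{..<?n} \<inter> support h (ys ! l). ?n - k)"
        by (simp add: sum.inter_restrict)
      also have "{..<?n} \<inter> support h (ys ! l) = support h (ys ! l)"
        using support_subset[OF nth(1)[OF that]] by blast
      finally show ?thesis .
    qed
    thus ?thesis
      by (simp add: corner_total_eq[OF support_mat_carrier])
  qed
  \<comment> \<open>The deficit of the letter \<open>h + 2\<close> is added on the left instead of
    being subtracted on the right.\<close>
  moreover have "(\<Sum>l<?n. (?n - l) * ?w l) + (\<Sum>l<?n. if l = ?p + 1 then ?n - l else 0) =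
      (\<Sum>l<?n. (?n - l) * (2 * h + 4)) + (\<Sum>l<?n. if l = ?p then ?n - l else 0)"
    unfolding sum.distrib[symmetric]
  proof (rule sum.cong)
    fix l assume "l \<in> {..<?n}"
    hence l: "l < ?n" by simp
    have "?w l + of_bool (l = ?p + 1) = 2 * h + 4 + of_bool (l = ?p)"
      using sum_support_weight[OF nth(1)[OF l]] nth(2,3)[OF l] by simp
    from arg_cong[OF this, of "(*) (?n - l)"]
    show "(?n - l) * ?w l + (if l = ?p + 1 then ?n - l else 0) =
        (?n - l) * (2 * h + 4) + (if l = ?p then ?n - l else 0)"
      by (simp only: distrib_left of_bool_def if_distrib[of "(*) _"] mult_1_right mult_0_right)
  qed simp
  moreover have "(\<Sum>l<?n. if l = ?p + 1 then ?n - l else 0) = ?n - (?p + 1)"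
    "(\<Sum>l<?n. if l = ?p then ?n - l else 0) = ?n - ?p"
    using p by (simp_all add: sum.delta)
  ultimately show ?thesis using p by linarith
qed

section \<open>Words with a doubled letter\<close>

text \<open>The letter \<open>h + 1\<close> stands for the pair of adjacent asymmetric columns.\<close>

definition expand :: "nat \<Rightarrow> nat list \<Rightarrow> nat list" where
  "expand h xs = concat (map (\<lambda>s. if s = h + 1 then [h + 1, h + 2] else [s]) xs)"

definition words :: "nat \<Rightarrow> nat list set" where
  "words h = permutations_of_multiset (mset [0..<h] + mset [0..<h + 2])"

text \<open>Deleting every \<open>h + 2\<close> inverts the expansion, since that letter is absent
  from the original word.\<close>

lemma inj_on_expand: "inj_on (expand h) {xs. set xs \<subseteq> {..h + 1}}"
proof (rule inj_on_inverseI)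
  fix xs assume "xs \<in> {xs. set xs \<subseteq> {..h + 1}}"
  hence "set xs \<subseteq> {..h + 1}" by simp
  thus "filter (\<lambda>s. s \<noteq> h + 2) (expand h xs) = xs"
    by (induction xs) (auto simp: expand_def)
qed

lemma expand_id: "h + 1 \<notin> set xs \<Longrightarrow> expand h xs = xs"
  by (induction xs) (auto simp: expand_def)

lemma words_set: "xs \<in> words h \<Longrightarrow> set xs = {..h + 1}"
  by (auto simp: words_def permutations_of_multiset_def dest!: arg_cong[of _ _ set_mset])

lemma expand_wordE:
  assumes "xs \<in> words h"
  obtains us vs where "expand h xs = us @ [h + 1, h + 2] @ vs" "set us \<subseteq> {..h}" "set vs \<subseteq> {..h}"
    "mset (expand h xs) = mset [0..<h] + mset [0..<h + 3]"
proof -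
  have mset: "mset xs = mset [0..<h] + mset [0..<h + 2]"
    using assms by (simp add: words_def permutations_of_multiset_def)
  have "h + 1 \<in> set xs" using words_set[OF assms] by simp
  then obtain us vs where xs: "xs = us @ (h + 1) # vs" by (meson split_list)
  \<comment> \<open>The letter \<open>h + 1\<close> has multiplicity one, so removing it leaves only
    letters up to \<open>h\<close> on both sides.\<close>
  have "mset us + mset vs = mset [0..<h] + mset [0..<h + 1]"
    using mset unfolding xs by simp
  hence sets: "set us \<union> set vs = {..h}"
    by (auto simp: set_eq_iff le_less dest!: arg_cong[of _ _ set_mset])
  hence "h + 1 \<notin> set us \<union> set vs" by simp
  hence "expand h us = us" "expand h vs = vs"
    by (simp_all add: expand_id)
  hence exp: "expand h xs = us @ [h + 1, h + 2] @ vs"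
    by (simp add: xs expand_def)
  have "mset (expand h xs) = mset xs + {#h + 2#}" unfolding exp by (simp add: xs)
  also have "\<dots> = mset [0..<h] + mset [0..<h + 3]"
    by (simp add: mset numeral_3_eq_3)
  finally show ?thesis using that exp sets by blast
qed

text \<open>This is the multinomial count: each of the \<open>h\<close> doubled letters contributes
  a factor \<open>fact 2 = 2\<close>, the two single letters contribute 1.\<close>

lemma card_words: "card (words h) * 2 ^ h = fact (2 * h + 2)"
proof -
  let ?M = "mset [0..<h] + mset [0..<h + 2]"
  have "(\<Prod>s\<in>set_mset ?M. fact (count ?M s)) = (\<Prod>s<h + 2. if s < h then 2 else 1 :: nat)"
    by (rule prod.cong) (auto simp: count_mset_0_iff distinct_count_atmost_1 of_bool_def)
  also have "\<dots> = 2 ^ h" by simp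
  finally show ?thesis
    using card_permutations_of_multiset_aux[of ?M]
    by (simp add: words_def mult_2 del: upt_Suc_append fact_Suc)
qed

theorem theorem5:
  fixes n :: nat
  assumes "n \<ge> 3" and "odd n"
  shows "\<exists>S. S \<subseteq> zero_one_class n 2 \<and> is_antichain bruhat_le S \<and> finite S \<and>
           real (card S) = fact (n - 1) / 2 ^ ((n - 3) div 2)"
proof -
  obtain m where "n = 2 * m + 1" using \<open>odd n\<close> by (elim oddE)
  with \<open>n \<ge> 3\<close> have "n = 2 * (m - 1) + 3" by simp
  \<comment> \<open>With this \<open>h\<close>, the word length \<open>2 * h + 2\<close> is
    \<open>n - 1\<close> and the exponent \<open>(n - 3) div 2\<close> is \<open>h\<close>.\<close>
  then obtain h where n: "n = 2 * h + 3" by blast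
  define S where "S = (support_mat h \<circ> expand h) ` words h"
  have expand: "length (expand h xs) = n" "set (expand h xs) \<subseteq> {..h + 2}"
    "mset (expand h xs) = mset [0..<h] + mset [0..<h + 3]" if "xs \<in> words h" for xs
  proof -
    show mset: "mset (expand h xs) = mset [0..<h] + mset [0..<h + 3]"
      using that by (rule expand_wordE)
    show "length (expand h xs) = n" "set (expand h xs) \<subseteq> {..h + 2}"
      using arg_cong[OF mset, of size] arg_cong[OF mset, of set_mset] by (auto simp: n)
  qed
  have "S \<subseteq> zero_one_class n 2"
    using support_mat_in_zero_one_class expand(3) by (auto simp: S_def n)
  moreover have "is_antichain bruhat_le S"
  proof -
    \<comment> \<open>The total on the right does not depend on \<open>A\<close>, so comparable
      members of \<open>S\<close> coincide.\<close>
    have "A \<in> carrier_mat n n \<and> corner_total A = (\<Sum>l<n. (n - l) * (2 * h + 4)) + 1"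
      if "A \<in> S" for A
    proof -
      obtain xs where xs: "xs \<in> words h" and A: "A = support_mat h (expand h xs)"
        using \<open>A \<in> S\<close> by (auto simp: S_def)
      from xs show ?thesis
        using corner_total_support_mat[of "expand h xs" h] expand(1)[OF xs] support_mat_carrier
        unfolding A n by (elim expand_wordE) blast
    qed
    thus ?thesis
      unfolding is_antichain_def by (metis bruhat_le_corner_total_eq)
  qed
  moreover have "finite S"
    by (simp add: S_def words_def)
  moreover have "real (card S) = fact (n - 1) / 2 ^ ((n - 3) div 2)"
  proof -
    have "inj_on (support_mat h \<circ> expand h) (words h)"
    proof (rule comp_inj_on)
      show "inj_on (expand h) (words h)"
        using inj_on_expand by (rule inj_on_subset) (auto simp: words_set)
      show "inj_on (support_mat h) (expand h ` words h)"
        using expand(1,2) unfolding n by (intro inj_onI, elim imageE) (metis support_mat_inject)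
    qed
    hence "card S = card (words h)" unfolding S_def by (rule card_image)
    hence "real (card S) * 2 ^ h = fact (2 * h + 2)"
      using arg_cong[OF card_words[of h], of real] by (simp del: fact_Suc)
    thus ?thesis by (simp add: n field_simps del: fact_Suc)
  qed
  ultimately show ?thesis by blast
qed

end
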